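(* For every integer $n\ge1$, the following identity of polynomials in $t$ holds: $$B_n(t^2)=(1+t)^{n+1}S_n(t)-2^n\,t\,S_n(t^2).$$
   Context: For $n\ge1$ let $[n]=\{1,\dots,n\}$ and let $S_n$ denote also the set of permutations $w=w_1\cdots w_n$ of $[n]$. The number of descents of a permutation $w$ is $\mathrm{des}(w)=|\{i\in\{1,\dots,n-1\}: w_i>w_{i+1}\}|$, and $\left\langle {n\atop k}\right\rangle$ is the number of permutations of $[n]$ with exactly $k$ descents. The type $A$ Eulerian polynomial is $S_n(t)=\sum_{k=0}^{n-1}\left\langle {n\atop k}\right\rangle t^k$. A signed permutation of $[n]$ is a permutation $u$ of $\{-n,\dots,-1,1,\dots,n\}$ with $u_{-i}=-u_i$ for all $i$. With the convention $u_0=0$, $\mathrm{des}_B(u)=|\{i\in\{0,1,\dots,n-1\}:u_i>u_{i+1}\}|$, and $\left\langle {n\atop k}\right\rangle_B$ is the number of signed permutations $u$ of $[n]$ with $\mathrm{des}_B(u)=k$. The type $B$ Eulerian polynomial is $B_n(t)=\sum_{k=0}^{n}\left\langle {n\atop k}\right\rangle_B t^k$. *)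

theory Defs
  imports "HOL-Combinatorics.Permutations" "HOL-Computational_Algebra.Polynomial"
begin

definition des :: "nat \<Rightarrow> (nat \<Rightarrow> nat) \<Rightarrow> nat" where
  "des n w = card {i \<in> {1..n - 1}. w i > w (i + 1)}"

definition eulerian :: "nat \<Rightarrow> nat \<Rightarrow> nat" where
  "eulerian n k = card {w. w permutes {1..n} \<and> des n w = k}"

definition eulerian_poly :: "nat \<Rightarrow> int poly" where
  "eulerian_poly n = (\<Sum>k = 0..n - 1. monom (int (eulerian n k)) k)"

definition signed_support :: "nat \<Rightarrow> int set" where
  "signed_support n = {- int n..int n} - {0}"

text \<open>
  Since \<open>permutes\<close> fixes every point outside the support, each signed permutation
  \<open>u\<close> satisfies the convention \<open>u 0 = 0\<close>.
\<close>

definition signed_permutation :: "nat \<Rightarrow> (int \<Rightarrow> int) \<Rightarrow> bool" where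
  "signed_permutation n u \<longleftrightarrow>
     u permutes signed_support n \<and> (\<forall>i \<in> signed_support n. u (- i) = - u i)"

definition des_B :: "nat \<Rightarrow> (int \<Rightarrow> int) \<Rightarrow> nat" where
  "des_B n u = card {i \<in> {0..int n - 1}. u i > u (i + 1)}"

definition eulerian_B :: "nat \<Rightarrow> nat \<Rightarrow> nat" where
  "eulerian_B n k = card {u. signed_permutation n u \<and> des_B n u = k}"

definition eulerian_poly_B :: "nat \<Rightarrow> int poly" where
  "eulerian_poly_B n = (\<Sum>k = 0..n. monom (int (eulerian_B n k)) k)"

end

theory Submission
  imports Defs
begin

text \<open>
  Both kinds of permutations are words over signed letters, read after an initial \<open>0\<close>: with
  all signs allowed in type B, with only positive signs in type A. Inserting the letters
  \<open>\<plusminus>(n + 1)\<close> into a word of length \<open>n\<close> yields first-order differential recurrences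
  for \<open>S\<^sub>n(t)\<close> and \<open>B\<^sub>n(t)\<close>, and the identity follows from these by induction on \<open>n\<close>,
  starting at \<open>n = 0\<close>.
\<close>

section \<open>Words, descents and insertion of a letter\<close>

fun desc_from :: "int \<Rightarrow> int list \<Rightarrow> nat" where
  "desc_from a [] = 0"
| "desc_from a (x # xs) = of_bool (a > x) + desc_from x xs"

definition insert_at :: "nat \<Rightarrow> 'a \<Rightarrow> 'a list \<Rightarrow> 'a list" where
  "insert_at i x xs = take i xs @ x # drop i xs"

lemma insert_at_0 [simp]: "insert_at 0 x xs = x # xs"
  by (simp add: insert_at_def)

lemma insert_at_Suc_Cons [simp]: "insert_at (Suc i) x (y # ys) = y # insert_at i x ys"
  by (simp add: insert_at_def)

lemma set_insert_at [simp]: "set (insert_at i x xs) = insert x (set xs)"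
proof -
  have "set (insert_at i x xs) = insert x (set (take i xs @ drop i xs))"
    unfolding insert_at_def set_append by auto
  then show ?thesis by (simp only: append_take_drop_id)
qed

lemma map_insert_at: "map f (insert_at i x xs) = insert_at i (f x) (map f xs)"
  by (simp add: insert_at_def take_map drop_map)

lemma distinct_insert_at [simp]:
  "distinct (insert_at i x xs) \<longleftrightarrow> x \<notin> set xs \<and> distinct xs"
proof -
  have "distinct (insert_at i x xs) \<longleftrightarrow> distinct (x # (take i xs @ drop i xs))"
    unfolding insert_at_def distinct_append distinct.simps set_append by auto
  then show ?thesis by (simp only: append_take_drop_id distinct.simps)
qed

text \<open>
  A new letter of largest absolute value creates exactly one descent when inserted between two
  letters, whatever its sign, so a gap that already is a descent stays one and an ascent gap gains one.
\<close>

lemma sum_desc_from_insert_at: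
  fixes t :: "'a::comm_ring_1"
  assumes "\<bar>a\<bar> < \<bar>m\<bar>" "\<forall>x\<in>set xs. \<bar>x\<bar> < \<bar>m\<bar>"
  shows "(\<Sum>i\<le>length xs. t ^ desc_from a (insert_at i m xs)) =
    of_nat (desc_from a xs) * t ^ desc_from a xs
    + (of_nat (length xs) - of_nat (desc_from a xs)) * t ^ Suc (desc_from a xs)
    + (if m > 0 then 1 else t) * t ^ desc_from a xs"
  using assms
proof (induction xs arbitrary: a)
  \<comment> \<open>The only gap is the end of the word, where a positive letter adds no descent and
    a negative one adds exactly one: the origin of the last summand.\<close>
  case Nil
  then show ?case by auto
next
  case (Cons x xs)
  have x: "\<bar>x\<bar> < \<bar>m\<bar>" using Cons.prems by simp
  have first: "desc_from a (m # x # xs) = Suc (desc_from x xs)"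
    using x Cons.prems(1) by (cases "m > 0") auto
  \<comment> \<open>The gap before \<open>x\<close> is split off; every other insertion keeps the
    step from \<open>a\<close> to \<open>x\<close> and falls under the induction hypothesis with
    \<open>x\<close> as the preceding letter.\<close>
  have "(\<Sum>i\<le>length (x # xs). t ^ desc_from a (insert_at i m (x # xs))) =
      t ^ Suc (desc_from x xs)
      + t ^ of_bool (a > x) * (\<Sum>i\<le>length xs. t ^ desc_from x (insert_at i m xs))"
    unfolding length_Cons sum.atMost_Suc_shift
    by (simp only: insert_at_0 insert_at_Suc_Cons first desc_from.simps(2)[of a x]
          power_add sum_distrib_left)
  then show ?case
    using Cons.IH[of x] x Cons.prems(2) by (auto simp: algebra_simps)
qed

text \<open>One-line notation: \<open>S = {1}\<close> yields the permutations of 1, ..., n and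
  \<open>S = {1, -1}\<close> the signed ones, a signed permutation being recorded by its values at
  1, ..., n.\<close>

definition signed_words :: "int set \<Rightarrow> nat \<Rightarrow> int list set" where
  "signed_words S n =
     {us. distinct (map abs us) \<and> abs ` set us = {1..int n} \<and> sgn ` set us \<subseteq> S}"

lemma length_signed_words:
  assumes "us \<in> signed_words S n"
  shows "length us = n"
proof -
  have "length us = card (set (map abs us))"
    using assms distinct_card[of "map abs us"] by (simp add: signed_words_def)
  then show ?thesis using assms by (simp add: signed_words_def)
qed

lemma abs_le_signed_words: "us \<in> signed_words S n \<Longrightarrow> x \<in> set us \<Longrightarrow> \<bar>x\<bar> \<le> int n"
  by (force simp: signed_words_def)

lemma signed_words_0: "signed_words S 0 = {[]}"
  by (auto simp: signed_words_def)

text \<open>The letter of absolute value n + 1 is unique in its word; its sign, its position and the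
  word left after deleting it recover the triple.\<close>

lemma bij_betw_insert_at_signed_words:
  assumes S: "S \<subseteq> {1, -1}"
  shows "bij_betw (\<lambda>(us, e, i). insert_at i (e * (int n + 1)) us)
           (signed_words S n \<times> S \<times> {..n}) (signed_words S (Suc n))"
proof (rule bij_betwI')
  fix p q
  assume p: "p \<in> signed_words S n \<times> S \<times> {..n}" and q: "q \<in> signed_words S n \<times> S \<times> {..n}"
  obtain us e i where [simp]: "p = (us, e, i)" by (cases p)
  obtain vs f j where [simp]: "q = (vs, f, j)" by (cases q)
  let ?M = "int n + 1"
  have e: "\<bar>e * ?M\<bar> = ?M" "\<bar>f * ?M\<bar> = ?M" using p q S by (auto simp: abs_mult)
  have small: "\<forall>x\<in>set us. \<bar>x\<bar> \<noteq> ?M" "\<forall>x\<in>set vs. \<bar>x\<bar> \<noteq> ?M"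
    using p q abs_le_signed_words by fastforce+
  have len: "length us = n" "length vs = n" using p q length_signed_words by auto
  \<comment> \<open>Deleting the large letter recovers the old word, and the prefix before it
    records the position.\<close>
  have tw: "takeWhile (\<lambda>x. \<bar>x\<bar> \<noteq> ?M) (insert_at i' y ws) = take i' ws"
    "filter (\<lambda>x. \<bar>x\<bar> \<noteq> ?M) (insert_at i' y ws) = ws"
    if "\<forall>x\<in>set ws. \<bar>x\<bar> \<noteq> ?M" "\<bar>y\<bar> = ?M" for i' y ws
  proof -
    have "\<forall>x\<in>set (take i' ws). \<bar>x\<bar> \<noteq> ?M" "\<forall>x\<in>set (drop i' ws). \<bar>x\<bar> \<noteq> ?M"
      using that(1) in_set_takeD in_set_dropD by metis+
    then show "takeWhile (\<lambda>x. \<bar>x\<bar> \<noteq> ?M) (insert_at i' y ws) = take i' ws"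
      "filter (\<lambda>x. \<bar>x\<bar> \<noteq> ?M) (insert_at i' y ws) = ws"
      using that(2) by (simp_all add: insert_at_def takeWhile_append)
  qed
  show "((case p of (us, e, i) \<Rightarrow> insert_at i (e * ?M) us) =
         (case q of (us, e, i) \<Rightarrow> insert_at i (e * ?M) us)) = (p = q)"
  proof
    assume "(case p of (us, e, i) \<Rightarrow> insert_at i (e * ?M) us) =
         (case q of (us, e, i) \<Rightarrow> insert_at i (e * ?M) us)"
    then have eq: "insert_at i (e * ?M) us = insert_at j (f * ?M) vs" by simp
    have usvs: "us = vs" using tw(2) small e eq by metis
    have "take i us = take j vs" using tw(1) small e eq by metis
    \<comment> \<open>Positions are at most \<open>n\<close>, the length of both words, so the
      prefixes have lengths exactly \<open>i\<close> and \<open>j\<close>.\<close>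
    then have "length (take i us) = length (take j vs)" by simp
    then have ij: "i = j" using p q len by simp
    have "e = f" using eq usvs ij by (simp add: insert_at_def)
    then show "p = q" using usvs ij by simp
  qed simp
next
  fix p
  assume "p \<in> signed_words S n \<times> S \<times> {..n}"
  then obtain us e i where [simp]: "p = (us, e, i)" and us: "us \<in> signed_words S n" and e: "e \<in> S"
    by (cases p) auto
  have abs: "\<bar>e * (int n + 1)\<bar> = int n + 1" using e S by (auto simp: abs_mult)
  have sgn: "sgn (e * (int n + 1)) = e" using e S by (auto simp: sgn_mult)
  show "(case p of (us, e, i) \<Rightarrow> insert_at i (e * (int n + 1)) us) \<in> signed_words S (Suc n)"
    using us e by (auto simp: signed_words_def map_insert_at abs sgn simp del: mult_minus_left)
next
  fix vs
  assume vs: "vs \<in> signed_words S (Suc n)"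
  let ?M = "int n + 1"
  have "?M \<in> abs ` set vs" using vs by (simp add: signed_words_def)
  then obtain y where y: "y \<in> set vs" "\<bar>y\<bar> = ?M" by auto
  then obtain as bs where split: "vs = as @ y # bs" by (meson split_list)
  \<comment> \<open>Distinct absolute values exclude a second letter of absolute value n +
    1.\<close>
  have "insert ?M (abs ` set (as @ bs)) = {1..int (Suc n)}" "?M \<notin> abs ` set (as @ bs)"
    using vs y(2) by (auto simp: signed_words_def split)
  then have "abs ` set (as @ bs) = {1..int (Suc n)} - {?M}" by blast
  also have "\<dots> = {1..int n}" by auto
  finally have w: "as @ bs \<in> signed_words S n"
    using vs unfolding signed_words_def split by auto
  have "sgn y \<in> S" using vs y by (auto simp: signed_words_def)
  moreover have "length as \<le> n" using length_signed_words[OF w] by simp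
  moreover have "vs = insert_at (length as) (sgn y * ?M) (as @ bs)"
    using y(2) by (simp add: insert_at_def split mult_sgn_abs flip: y(2))
  ultimately show "\<exists>p\<in>signed_words S n \<times> S \<times> {..n}.
      vs = (case p of (us, e, i) \<Rightarrow> insert_at i (e * ?M) us)"
    using w by force
qed

section \<open>The descent polynomial and its differential recurrence\<close>

definition X :: "int poly" where "X = [:0, 1:]"

lemma pderiv_X [simp]: "pderiv X = 1"
  by (simp add: X_def pderiv_pCons)

text \<open>The initial 0 encodes the convention u_0 = 0; before a positive letter it creates no
  descent, so the same statistic serves type A.\<close>

definition desc_poly :: "int set \<Rightarrow> nat \<Rightarrow> int poly" where
  "desc_poly S n = (\<Sum>us\<in>signed_words S n. X ^ desc_from 0 us)"

lemma pderiv_sum: "pderiv (sum f A) = (\<Sum>x\<in>A. pderiv (f x))"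
  using higher_pderiv_sum[of 1 f A] by simp

text \<open>Multiplying by \<open>X\<close> lets the derivative read off the exponent with no
  exception at \<open>d = 0\<close>.\<close>

lemma X_times_pderiv_X_power: "X * pderiv (X ^ d) = of_nat d * X ^ d"
proof (cases d)
  case (Suc k)
  have "pderiv (X ^ d) = of_nat d * X ^ k"
    unfolding Suc pderiv_power_Suc by (simp add: of_nat_poly)
  then show ?thesis by (simp add: Suc)
qed simp

text \<open>For each sign, a word with d descents contributes d X^d + (n - d) X^(d+1) through the
  gaps before its letters, and this equals n X X^d + X (1 - X) (X^d)'. The end gap contributes X^d
  times 1 or \<open>X\<close>, according to the sign.\<close>

lemma desc_poly_Suc:
  assumes S: "S \<subseteq> {1, -1}"
  shows "desc_poly S (Suc n) =
    of_nat (card S) * (of_nat n * X * desc_poly S n + X * (1 - X) * pderiv (desc_poly S n))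
    + (\<Sum>e\<in>S. if e > 0 then 1 else X) * desc_poly S n"
proof -
  have inner: "(\<Sum>i\<le>n. X ^ desc_from 0 (insert_at i (e * (int n + 1)) us)) =
      of_nat n * X * X ^ desc_from 0 us + X * (1 - X) * pderiv (X ^ desc_from 0 us)
      + (if e > 0 then 1 else X) * X ^ desc_from 0 us"
    if us: "us \<in> signed_words S n" and e: "e \<in> S" for us e
  proof -
    have abs: "\<bar>e * (int n + 1)\<bar> = int n + 1" using e S by (auto simp: abs_mult)
    have pos: "e * (int n + 1) > 0 \<longleftrightarrow> e > 0" by (simp add: zero_less_mult_iff)
    have "\<forall>x\<in>set us. \<bar>x\<bar> < \<bar>e * (int n + 1)\<bar>"
      using abs_le_signed_words[OF us] abs by fastforce
    then have "(\<Sum>i\<le>n. X ^ desc_from 0 (insert_at i (e * (int n + 1)) us)) =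
        of_nat (desc_from 0 us) * X ^ desc_from 0 us
        + (of_nat n - of_nat (desc_from 0 us)) * X ^ Suc (desc_from 0 us)
        + (if e > 0 then 1 else X) * X ^ desc_from 0 us"
      using sum_desc_from_insert_at[of 0 "e * (int n + 1)" us X] abs pos
        length_signed_words[OF us] by simp
    moreover have "X * (1 - X) * pderiv (X ^ desc_from 0 us) =
        (1 - X) * (of_nat (desc_from 0 us) * X ^ desc_from 0 us)"
      using X_times_pderiv_X_power[of "desc_from 0 us"] by (metis mult.assoc mult.commute)
    ultimately show ?thesis by (simp add: algebra_simps)
  qed
  have "desc_poly S (Suc n) = (\<Sum>(us, e, i)\<in>signed_words S n \<times> S \<times> {..n}.
      X ^ desc_from 0 (insert_at i (e * (int n + 1)) us))"
    unfolding desc_poly_def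
    by (subst sum.reindex_bij_betw[OF bij_betw_insert_at_signed_words[OF S], symmetric])
       (simp add: case_prod_unfold)
  also have "\<dots> = (\<Sum>us\<in>signed_words S n. \<Sum>e\<in>S. \<Sum>i\<le>n.
      X ^ desc_from 0 (insert_at i (e * (int n + 1)) us))"
    by (simp add: sum.cartesian_product)
  also have "\<dots> = (\<Sum>us\<in>signed_words S n. \<Sum>e\<in>S.
      of_nat n * X * X ^ desc_from 0 us + X * (1 - X) * pderiv (X ^ desc_from 0 us)
      + (if e > 0 then 1 else X) * X ^ desc_from 0 us)"
    using inner by (intro sum.cong refl) blast
  also have "\<dots> = (\<Sum>us\<in>signed_words S n.
      of_nat (card S) * (of_nat n * X * X ^ desc_from 0 us + X * (1 - X) * pderiv (X ^ desc_from 0 us))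
      + (\<Sum>e\<in>S. if e > 0 then 1 else X) * X ^ desc_from 0 us)"
    by (simp only: sum.distrib[of _ _ S] sum_constant sum_distrib_right[of _ S])
  also have "\<dots> =
    of_nat (card S) * (of_nat n * X * desc_poly S n + X * (1 - X) * pderiv (desc_poly S n))
    + (\<Sum>e\<in>S. if e > 0 then 1 else X) * desc_poly S n"
    unfolding desc_poly_def
    by (simp only: sum.distrib sum_distrib_left[symmetric] pderiv_sum)
  finally show ?thesis .
qed

section \<open>From permutations and signed permutations to words\<close>

lemma desc_from_map_upt:
  assumes "m \<le> n"
  shows "desc_from (f m) (map f [Suc m..<Suc n]) = card {i \<in> {m..<n}. f i > f (Suc i)}"
  using assms
proof (induction m rule: inc_induct)
  case base
  then show ?case by simp
next
  case (step m)
  have upt: "[Suc m..<Suc n] = Suc m # [Suc (Suc m)..<Suc n]"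
    using step.hyps by (simp add: upt_conv_Cons del: upt_Suc)
  have "{i \<in> {m..<n}. f i > f (Suc i)} =
      (if f m > f (Suc m) then {m} else {}) \<union> {i \<in> {Suc m..<n}. f i > f (Suc i)}"
    using step.hyps by (auto simp: Suc_le_eq le_less)
  then have "card {i \<in> {m..<n}. f i > f (Suc i)} =
      of_bool (f m > f (Suc m)) + card {i \<in> {Suc m..<n}. f i > f (Suc i)}"
    by (auto simp: card_insert_if)
  then show ?case using step.IH unfolding upt by (simp del: upt_Suc)
qed

text \<open>The fibres of \<open>d\<close> partition \<open>A\<close>, and the bound on
  \<open>d\<close> ensures that the sum over k misses none of them.\<close>

lemma sum_monom_card_fibres:
  assumes "finite A" "\<And>w. w \<in> A \<Longrightarrow> d w \<le> m"
  shows "(\<Sum>k = 0..m. monom (int (card {w \<in> A. d w = k})) k) = (\<Sum>w\<in>A. X ^ d w)"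
proof -
  have "(\<Sum>w\<in>A. X ^ d w) = (\<Sum>k = 0..m. \<Sum>w | w \<in> A \<and> d w = k. X ^ d w)"
    using assms by (intro sum.group[symmetric]) auto
  also have "\<dots> = (\<Sum>k = 0..m. monom (int (card {w \<in> A. d w = k})) k)"
    by (intro sum.cong refl) (simp add: monom_altdef X_def of_nat_poly)
  finally show ?thesis by simp
qed

text \<open>One-line notation is a bijection onto the words with positive letters, and it carries
  \<open>des\<close> to the descents read after 0.\<close>

lemma eulerian_poly_conv_desc_poly: "eulerian_poly n = desc_poly {1} n"
proof -
  let ?A = "{w. w permutes {1..n}}"
  let ?h = "\<lambda>w :: nat \<Rightarrow> nat. map (\<lambda>i. int (w i)) [Suc 0..<Suc n]"
  have des_le: "des n w \<le> n - 1" for w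
    unfolding des_def by (rule order_trans[OF card_mono[of "{1..n - 1}"]]) auto
  have des: "desc_from 0 (?h w) = des n w" if "w permutes {1..n}" for w
  proof -
    have w0: "w 0 = 0" using that by (simp add: permutes_def)
    \<comment> \<open>Position 0 is never a descent since \<open>w 0 = 0\<close>, so the range 0,
      ..., n - 1 shrinks to 1, ..., n - 1.\<close>
    have "{i \<in> {0..<n}. int (w i) > int (w (Suc i))} = {i \<in> {1..n - 1}. w i > w (i + 1)}"
    proof (intro set_eqI)
      fix i
      show "i \<in> {i \<in> {0..<n}. int (w i) > int (w (Suc i))} \<longleftrightarrow>
        i \<in> {i \<in> {1..n - 1}. w i > w (i + 1)}"
        by (cases i) (auto simp: w0)
    qed
    then show ?thesis
      using desc_from_map_upt[of 0 n "\<lambda>i. int (w i)"] by (simp add: w0 des_def del: upt_Suc)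
  qed
  have bij: "bij_betw ?h ?A (signed_words {1} n)"
  proof (rule bij_betwI')
    fix v w assume v: "v \<in> ?A" and w: "w \<in> ?A"
    show "(?h v = ?h w) = (v = w)"
    proof
      assume "?h v = ?h w"
      then have "\<forall>i\<in>{Suc 0..<Suc n}. v i = w i" by (simp del: upt_Suc)
      then have "\<forall>i\<in>{1..n}. v i = w i" by auto
      then show "v = w" using v w by (auto simp: permutes_def fun_eq_iff)
    qed simp
  next
    fix w assume "w \<in> ?A"
    then have w: "w permutes {1..n}" by simp
    have S: "set [Suc 0..<Suc n] = {1..n}" by auto
    have "inj_on (\<lambda>i. int (w i)) {1..n}"
      using permutes_inj_on[OF w] by (auto simp: inj_on_def)
    moreover have "(\<lambda>i. int (w i)) ` {1..n} = {1..int n}"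
      using permutes_image[OF w] image_int_atLeastAtMost[of 1 n] by (metis image_image of_nat_1)
    moreover have "w i \<ge> 1" if "i \<in> {1..n}" for i
      using permutes_in_image[OF w, of i] that by simp
    ultimately show "?h w \<in> signed_words {1} n"
      unfolding signed_words_def mem_Collect_eq
      by (auto simp: distinct_map S image_image comp_def simp del: upt_Suc set_upt)
  next
    fix us assume us: "us \<in> signed_words {1} n"
    \<comment> \<open>Lists are indexed from 0, hence \<open>i - 1\<close>; the letters are
      positive, so \<open>nat\<close> loses nothing; all other points are fixed, as
      \<open>permutes\<close> demands.\<close>
    define w where "w i = (if i \<in> {1..n} then nat (us ! (i - 1)) else i)" for i
    have len: "length us = n" by (rule length_signed_words[OF us])
    have pos: "x > 0" if "x \<in> set us" for x
      using us that by (auto simp: signed_words_def sgn_1_pos)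
    have w_int: "int (w i) = us ! (i - 1)" if "i \<in> {1..n}" for i
    proof -
      have "us ! (i - 1) \<in> set us" using that len by (intro nth_mem) auto
      then show ?thesis using pos that by (fastforce simp: w_def)
    qed
    have dist: "distinct us" using us by (simp add: signed_words_def distinct_map)
    have inj: "inj_on w {1..n}"
    proof (rule inj_onI)
      fix i j assume ij: "i \<in> {1..n}" "j \<in> {1..n}" "w i = w j"
      then have "us ! (i - 1) = us ! (j - 1)" using w_int by metis
      then have "i - 1 = j - 1" using dist ij(1,2) len by (subst (asm) nth_eq_iff_index_eq) auto
      then show "i = j" using ij(1,2) by auto
    qed
    have into: "w ` {1..n} \<subseteq> {1..n}"
    proof
      fix y assume "y \<in> w ` {1..n}"
      then obtain i where i: "i \<in> {1..n}" "y = w i" by auto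
      then have "us ! (i - 1) \<in> set us" using len by (intro nth_mem) auto
      then have "int (w i) \<in> set us" using w_int i by simp
      then show "y \<in> {1..n}" using pos abs_le_signed_words[OF us] i by fastforce
    qed
    have "bij_betw w {1..n} {1..n}"
      using endo_inj_surj[OF _ into inj] inj by (simp add: bij_betw_def)
    then have "w permutes {1..n}" by (rule bij_imp_permutes) (auto simp: w_def)
    moreover have "us = ?h w"
      using w_int by (intro nth_equalityI) (auto simp: len simp del: upt_Suc)
    ultimately show "\<exists>w\<in>?A. us = ?h w" by blast
  qed
  have "eulerian_poly n = (\<Sum>w\<in>?A. X ^ des n w)"
    using sum_monom_card_fibres[of ?A "des n" "n - 1"] des_le
    by (simp add: eulerian_poly_def eulerian_def finite_permutations)
  also have "\<dots> = (\<Sum>w\<in>?A. X ^ desc_from 0 (?h w))"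
    using des by (intro sum.cong) (auto simp del: upt_Suc)
  also have "\<dots> = desc_poly {1} n"
    unfolding desc_poly_def by (rule sum.reindex_bij_betw[OF bij])
  finally show ?thesis .
qed

text \<open>By oddness a signed permutation is determined by its values at 1, ..., n, and any word
  with signs in \<open>{1, -1}\<close> arises from such values. Since 0 is fixed,
  \<open>des_B\<close> counts the descents read after 0.\<close>

lemma eulerian_poly_B_conv_desc_poly: "eulerian_poly_B n = desc_poly {1, -1} n"
proof -
  let ?A = "{u. signed_permutation n u}"
  let ?h = "\<lambda>u :: int \<Rightarrow> int. map (\<lambda>i. u (int i)) [Suc 0..<Suc n]"
  let ?S = "signed_support n"
  have finS: "finite ?S" by (simp add: signed_support_def)
  have finA: "finite ?A"
    by (rule finite_subset[OF _ finite_permutations[OF finS]]) (auto simp: signed_permutation_def)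
  have des_le: "des_B n u \<le> n" for u
  proof -
    have "des_B n u \<le> card {0..int n - 1}" unfolding des_B_def by (intro card_mono) auto
    then show ?thesis by simp
  qed
  have des: "desc_from 0 (?h u) = des_B n u" if "signed_permutation n u" for u
  proof -
    have u0: "u 0 = 0"
      using that by (simp add: signed_permutation_def permutes_def signed_support_def)
    have "{i \<in> {0..int n - 1}. u i > u (i + 1)} =
        int ` {i \<in> {0..<n}. u (int i) > u (int (Suc i))}"
    proof (intro set_eqI iffI)
      fix i assume "i \<in> {i \<in> {0..int n - 1}. u i > u (i + 1)}"
      then show "i \<in> int ` {i \<in> {0..<n}. u (int i) > u (int (Suc i))}"
        by (intro image_eqI[of _ _ "nat i"]) (auto simp: add.commute)
    qed (auto simp: add.commute)
    then show ?thesis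
      using desc_from_map_upt[of 0 n "\<lambda>i. u (int i)"]
      by (simp add: u0 des_B_def card_image del: upt_Suc)
  qed
  have S_cases: "\<exists>k\<in>{1..n}. x = int k \<or> x = - int k" if "x \<in> ?S" for x
    using that by (intro bexI[of _ "nat \<bar>x\<bar>"]) (auto simp: signed_support_def)
  have S_int: "int k \<in> ?S" "- int k \<in> ?S" if "k \<in> {1..n}" for k
    using that by (auto simp: signed_support_def)
  have bij: "bij_betw ?h ?A (signed_words {1, -1} n)"
  proof (rule bij_betwI')
    fix u v assume u: "u \<in> ?A" and v: "v \<in> ?A"
    show "(?h u = ?h v) = (u = v)"
    proof
      assume "?h u = ?h v"
      then have "\<forall>i\<in>{Suc 0..<Suc n}. u (int i) = v (int i)" by (simp del: upt_Suc)
      then have eq: "\<forall>i\<in>{1..n}. u (int i) = v (int i)" by auto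
      have "u x = v x" for x
      proof (cases "x \<in> ?S")
        case True
        then show ?thesis
          using S_cases[OF True] eq S_int u v by (auto simp: signed_permutation_def)
      next
        case False
        then show ?thesis using u v by (simp add: signed_permutation_def permutes_def)
      qed
      then show "u = v" by blast
    qed simp
  next
    fix u assume "u \<in> ?A"
    then have u: "u permutes ?S" and odd: "\<And>i. i \<in> ?S \<Longrightarrow> u (- i) = - u i"
      by (auto simp: signed_permutation_def)
    have S: "set [Suc 0..<Suc n] = {1..n}" by auto
    have inS: "u x \<in> ?S" if "x \<in> ?S" for x using permutes_in_image[OF u] that by simp
    \<comment> \<open>Equal absolute values at i and j mean that \<open>u\<close> agrees at i and j
      or at i and -j; as \<open>u\<close> is injective and both indices are positive, i = j.\<close>
    have inj: "inj_on (\<lambda>i. \<bar>u (int i)\<bar>) {1..n}"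
    proof (rule inj_onI)
      fix i j assume ij: "i \<in> {1..n}" "j \<in> {1..n}" "\<bar>u (int i)\<bar> = \<bar>u (int j)\<bar>"
      then have "u (int i) = u (int j) \<or> u (int i) = u (- int j)"
        using odd[OF S_int(1)[OF ij(2)]] by auto
      then have "int i = int j \<or> int i = - int j"
        using permutes_inj[OF u] by (simp only: inj_eq)
      then show "i = j" using ij by auto
    qed
    have into: "(\<lambda>i. \<bar>u (int i)\<bar>) ` {1..n} \<subseteq> {1..int n}"
      using inS[OF S_int(1)] by (fastforce simp: signed_support_def)
    \<comment> \<open>By injectivity the image has n elements, so its inclusion in a set of size n
      is an equality.\<close>
    have "(\<lambda>i. \<bar>u (int i)\<bar>) ` {1..n} = {1..int n}"
      by (rule card_subset_eq[OF _ into]) (simp, subst card_image[OF inj], simp)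
    moreover have "u (int i) \<noteq> 0" if "i \<in> {1..n}" for i
      using inS[OF S_int(1)[OF that]] by (simp add: signed_support_def)
    ultimately show "?h u \<in> signed_words {1, -1} n"
      using inj unfolding signed_words_def mem_Collect_eq
      by (auto simp: distinct_map S image_image comp_def sgn_if simp del: upt_Suc set_upt)
  next
    fix us assume us: "us \<in> signed_words {1, -1} n"
    \<comment> \<open>The odd extension of the word: \<open>sgn x\<close> carries the sign over to
      negative points, and points outside the support, 0 among them, stay fixed.\<close>
    define u where "u x = (if x \<in> ?S then sgn x * us ! (nat \<bar>x\<bar> - 1) else x)" for x
    have len: "length us = n" by (rule length_signed_words[OF us])
    have inj_us: "i = j" if "i < n" "j < n" "\<bar>us ! i\<bar> = \<bar>us ! j\<bar>" for i j
      using us that len nth_eq_iff_index_eq[of "map abs us" i j] by (simp add: signed_words_def)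
    have us_S: "us ! i \<in> ?S" if "i < n" for i
    proof -
      have "\<bar>us ! i\<bar> \<in> abs ` set us" using that len by simp
      then have "\<bar>us ! i\<bar> \<in> {1..int n}" using us by (simp add: signed_words_def)
      then show ?thesis by (auto simp: signed_support_def)
    qed
    have odd: "u (- x) = - u x" if "x \<in> ?S" for x
      using that by (auto simp: u_def signed_support_def)
    have u_int: "u (int k) = us ! (k - 1)" if "k \<in> {1..n}" for k
      using that S_int[OF that] by (simp add: u_def)
    have into: "u ` ?S \<subseteq> ?S"
    proof
      fix y assume "y \<in> u ` ?S"
      then obtain x where x: "x \<in> ?S" "y = u x" by auto
      obtain k where k: "k \<in> {1..n}" "x = int k \<or> x = - int k" using S_cases[OF x(1)] by auto
      have "us ! (k - 1) \<in> ?S" using us_S k by auto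
      then show "y \<in> ?S"
        using x k odd[OF S_int(1)[OF k(1)]] u_int[OF k(1)] by (auto simp: signed_support_def)
    qed
    have inj: "inj_on u ?S"
    proof (rule inj_onI)
      fix x y assume xy: "x \<in> ?S" "y \<in> ?S" "u x = u y"
      obtain k where k: "k \<in> {1..n}" "x = int k \<or> x = - int k" using S_cases[OF xy(1)] by auto
      obtain l where l: "l \<in> {1..n}" "y = int l \<or> y = - int l" using S_cases[OF xy(2)] by auto
      have ux: "u x = us ! (k - 1) \<and> x = int k \<or> u x = - us ! (k - 1) \<and> x = - int k"
        using k odd[OF S_int(1)[OF k(1)]] u_int[OF k(1)] by auto
      have uy: "u y = us ! (l - 1) \<and> y = int l \<or> u y = - us ! (l - 1) \<and> y = - int l"
        using l odd[OF S_int(1)[OF l(1)]] u_int[OF l(1)] by auto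
      have "\<bar>us ! (k - 1)\<bar> = \<bar>us ! (l - 1)\<bar>" using ux uy xy(3) by auto
      then have "k - 1 = l - 1" using k(1) l(1) by (intro inj_us) auto
      then have "k = l" using k(1) l(1) by auto
      \<comment> \<open>A nonzero letter differs from its negative, so \<open>x\<close> and
        \<open>y\<close> also agree in sign.\<close>
      moreover have "us ! (k - 1) \<noteq> 0" using us_S[of "k - 1"] k(1) by (force simp: signed_support_def)
      ultimately show "x = y" using ux uy xy(3) by auto
    qed
    have "bij_betw u ?S ?S"
      using endo_inj_surj[OF finS into inj] inj by (simp add: bij_betw_def)
    then have "u permutes ?S" by (rule bij_imp_permutes) (auto simp: u_def)
    then have "signed_permutation n u" using odd by (simp add: signed_permutation_def)
    moreover have "us = ?h u"
    proof (rule nth_equalityI)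
      fix i assume "i < length us"
      then show "us ! i = ?h u ! i" using u_int[of "Suc i"] len by (simp del: upt_Suc)
    qed (simp add: len del: upt_Suc)
    ultimately show "\<exists>u\<in>?A. us = ?h u" by blast
  qed
  have "eulerian_poly_B n = (\<Sum>u\<in>?A. X ^ des_B n u)"
    using sum_monom_card_fibres[of ?A "des_B n" n] des_le finA
    by (simp add: eulerian_poly_B_def eulerian_B_def)
  also have "\<dots> = (\<Sum>u\<in>?A. X ^ desc_from 0 (?h u))"
    using des by (intro sum.cong) (auto simp del: upt_Suc)
  also have "\<dots> = desc_poly {1, -1} n"
    unfolding desc_poly_def by (rule sum.reindex_bij_betw[OF bij])
  finally show ?thesis .
qed

section \<open>Initial values and recurrences of the two Eulerian polynomials\<close>

lemma eulerian_poly_0: "eulerian_poly 0 = 1" and eulerian_poly_B_0: "eulerian_poly_B 0 = 1"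
  by (simp_all add: eulerian_poly_conv_desc_poly eulerian_poly_B_conv_desc_poly desc_poly_def
        signed_words_0)

lemma eulerian_poly_Suc:
  "eulerian_poly (Suc n) =
     (1 + of_nat n * X) * eulerian_poly n + X * (1 - X) * pderiv (eulerian_poly n)"
  using desc_poly_Suc[of "{1}" n] unfolding eulerian_poly_conv_desc_poly
  by (simp add: algebra_simps)

text \<open>The two signs double the contribution of the gaps before letters, and the end gap yields
  the factor 1 + X in place of the 1 of type A.\<close>

lemma eulerian_poly_B_Suc:
  "eulerian_poly_B (Suc n) =
     (1 + (2 * of_nat n + 1) * X) * eulerian_poly_B n + 2 * (X * (1 - X)) * pderiv (eulerian_poly_B n)"
proof -
  have "(\<Sum>e\<in>{1, -1 :: int}. if e > 0 then 1 else X) = 1 + X" by simp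
  moreover have "of_nat (card {1, -1 :: int}) = (2 :: int poly)" by simp
  ultimately show ?thesis
    using desc_poly_Suc[of "{1, -1}" n] unfolding eulerian_poly_B_conv_desc_poly
    by (simp add: algebra_simps)
qed

section \<open>Substitution of the square and the identity\<close>

lemma pcompose_of_nat: "pcompose (of_nat k) (q :: 'a::comm_semiring_1 poly) = of_nat k"
  by (simp add: of_nat_poly pcompose_const)

lemma pcompose_X: "pcompose X q = q"
  by (simp add: X_def pcompose_pCons)

lemma pderiv_pcompose_X_squared:
  "pderiv (pcompose p (X ^ 2)) = 2 * X * pcompose (pderiv p) (X ^ 2)"
  by (simp add: pderiv_pcompose pderiv_mult power2_eq_square algebra_simps)

text \<open>Doubling supplies the factor 2 of the chain rule, so the derivative of the substituted
  polynomial can appear without division.\<close>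

lemma eulerian_poly_Suc_squared:
  "2 * pcompose (eulerian_poly (Suc n)) (X ^ 2) =
     2 * (1 + of_nat n * X ^ 2) * pcompose (eulerian_poly n) (X ^ 2)
     + X * (1 - X ^ 2) * pderiv (pcompose (eulerian_poly n) (X ^ 2))"
  unfolding eulerian_poly_Suc pderiv_pcompose_X_squared
  by (simp only: pcompose_add pcompose_mult pcompose_diff pcompose_1 pcompose_of_nat pcompose_X)
     algebra

text \<open>Here the 2 coming from the two signs already matches the chain rule, so no doubling
  occurs.\<close>

lemma eulerian_poly_B_Suc_squared:
  "pcompose (eulerian_poly_B (Suc n)) (X ^ 2) =
     (1 + (2 * of_nat n + 1) * X ^ 2) * pcompose (eulerian_poly_B n) (X ^ 2)
     + X * (1 - X ^ 2) * pderiv (pcompose (eulerian_poly_B n) (X ^ 2))"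
proof -
  have two: "pcompose 2 q = 2" for q :: "int poly"
    using pcompose_of_nat[of 2 q] by simp
  show ?thesis
    unfolding eulerian_poly_B_Suc pderiv_pcompose_X_squared
    by (simp only: pcompose_add pcompose_mult pcompose_diff pcompose_1 pcompose_of_nat pcompose_X two)
       algebra
qed

text \<open>
  After the substitution of \<open>t\<^sup>2\<close>, the recurrence for type B involves only the derivative of
  the substituted polynomial, so both sides obey the same first-order recurrence.
\<close>

lemma eulerian_poly_B_squared:
  "pcompose (eulerian_poly_B n) (X ^ 2) =
     (1 + X) ^ (n + 1) * eulerian_poly n - 2 ^ n * X * pcompose (eulerian_poly n) (X ^ 2)"
proof (induction n)
  case 0
  show ?case by (simp add: eulerian_poly_0 eulerian_poly_B_0 pcompose_1)
next
  case (Suc n)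
  \<comment> \<open>Under these names the induction step becomes a polynomial identity in
    \<open>X\<close>, \<open>S\<close>, \<open>s\<close>, \<open>N\<close>, \<open>P\<close>,
    \<open>T\<close> and the derivatives of \<open>S\<close> and \<open>s\<close>.\<close>
  define S where "S = eulerian_poly n"
  define s where "s = pcompose S (X ^ 2)"
  define N :: "int poly" where "N = of_nat n"
  define P where "P = (1 + X) ^ n"
  define T :: "int poly" where "T = 2 ^ n"
  have dP: "pderiv ((1 + X) ^ (n + 1)) = (N + 1) * P"
    unfolding P_def N_def Suc_eq_plus1[symmetric] pderiv_power_Suc
    by (simp add: pderiv_add of_nat_poly smult_add_left distrib_right)
  have dT: "pderiv T = 0"
    unfolding T_def by (induction n) (simp_all add: pderiv_mult pderiv_numeral)
  have IH: "pcompose (eulerian_poly_B n) (X ^ 2) = (1 + X) ^ (n + 1) * S - T * X * s"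
    using Suc.IH by (simp only: S_def s_def T_def)
  have dB: "pderiv (pcompose (eulerian_poly_B n) (X ^ 2)) =
      (N + 1) * P * S + (1 + X) * P * pderiv S - T * s - T * X * pderiv s"
    unfolding IH by (simp only: pderiv_diff pderiv_mult dP dT pderiv_X) (simp add: P_def algebra_simps)
  have P: "(1 + X) ^ (n + 1) = (1 + X) * P" "(1 + X) ^ (Suc n + 1) = (1 + X) ^ 2 * P"
    by (simp_all add: P_def power2_eq_square mult.assoc)
  \<comment> \<open>The new factor 2 in \<open>2 ^ Suc n\<close> is the one that the doubled type A
    recurrence needs.\<close>
  have "2 ^ Suc n * X * pcompose (eulerian_poly (Suc n)) (X ^ 2) =
      T * X * (2 * pcompose (eulerian_poly (Suc n)) (X ^ 2))"
    by (simp only: T_def power_Suc mult_ac)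
  also have "\<dots> = T * X * (2 * (1 + N * X ^ 2) * s + X * (1 - X ^ 2) * pderiv s)"
    by (simp only: eulerian_poly_Suc_squared S_def s_def N_def)
  finally have T: "2 ^ Suc n * X * pcompose (eulerian_poly (Suc n)) (X ^ 2) = \<dots>" .
  \<comment> \<open>The terms in \<open>pderiv S\<close> agree because (1 - X^2) (1 + X) = (1 - X)
    (1 + X)^2; those in \<open>pderiv s\<close> have the same coefficient on both sides.\<close>
  show ?case
    unfolding eulerian_poly_B_Suc_squared T
    unfolding dB unfolding IH P eulerian_poly_Suc S_def[symmetric] N_def[symmetric]
    by algebra
qed

theorem mainTheorem2:
  fixes n :: nat and t :: "int poly"
  defines "t \<equiv> [:0, 1:]"
  assumes "n \<ge> 1"
  shows "pcompose (eulerian_poly_B n) (t ^ 2) =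
           (1 + t) ^ (n + 1) * eulerian_poly n - 2 ^ n * t * pcompose (eulerian_poly n) (t ^ 2)"
  unfolding t_def using eulerian_poly_B_squared by (simp only: X_def)

end
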